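(* Let $(X,d)$ be a metric space. For all $k=0,1,2,\dots$ there is an isomorphism $$\lim_{\epsilon\in\boldsymbol{(0,\infty)}} H_k\big(CN(X)(\epsilon)\big)\;\cong\;\mathcal{H}_k(X),$$ where $\mathcal{H}_k(X)=\lim_{\epsilon\in\boldsymbol{(0,\infty)}} H_k\big(CV^{\mathrm{sing}}(X)(\epsilon)\big)$ is the Vietoris homology of $X$.
   Context: Let $\boldsymbol{(0,\infty)}$ be the category whose objects are the positive real numbers, with exactly one morphism $\epsilon\to\epsilon'$ whenever $\epsilon\le\epsilon'$ (and no others). Limits are categorical limits of functors $\boldsymbol{(0,\infty)}\to\mathrm{Ab}$ in the category $\mathrm{Ab}$ of abelian groups. Enriched nerve: $N(X)(\epsilon)$ is the simplicial set with $n$-simplices $$N(X)(\epsilon)_n=\Big\{(x_0,\dots,x_n)\ \Big|\ x_i\in X,\ \sum_{i=0}^{n-1} d(x_i,x_{i+1})\le\epsilon\Big\}.$$ Vietoris--Rips simplicial set: $V^{\mathrm{sing}}(X)(\epsilon)$ is the simplicial set with $n$-simplices $$V^{\mathrm{sing}}(X)(\epsilon)_n=\big\{(x_0,\dots,x_n)\ \big|\ x_i\in X,\ d(x_i,x_j)\le\epsilon\text{ for all }i,j\in\{0,\dots,n\}\big\}.$$ In both cases the $i$th face map deletes the entry $x_i$, the $i$th degeneracy map repeats the entry $x_i$, and for $\epsilon\le\epsilon'$ the simplicial set at $\epsilon$ is included in that at $\epsilon'$, giving functors $\boldsymbol{(0,\infty)}\to\mathrm{sSet}$. $CN(X)$ and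 $CV^{\mathrm{sing}}(X)$ denote the functors $\boldsymbol{(0,\infty)}\to\mathrm{ch}_{\mathrm{Ab}}$ (chain complexes of abelian groups) obtained by composing $N(X)$, respectively $V^{\mathrm{sing}}(X)$, with the free abelian group functor $\mathbb{Z}[\cdot]\colon\mathrm{sSet}\to\mathrm{sAb}$ and the unnormalised chain complex functor $\mathrm{sAb}\to\mathrm{ch}_{\mathrm{Ab}}$ (boundary map equal to the alternating sum of the face maps). $H_k$ is the usual $k$th homology functor. *)

theory Defs
  imports "HOL-Analysis.Abstract_Metric_Spaces" "HOL-Algebra.Free_Abelian_Groups"
begin

section \<open>Simplicial sets\<close>

text \<open>The map \<^term>\<open>face S n i\<close> goes from the \<open>n\<close>-simplices to the \<open>(n - 1)\<close>-simplices and is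
  meaningful for \<open>n \<ge> 1\<close>; \<^term>\<open>degen S n i\<close> goes from the \<open>n\<close>-simplices to the
  \<open>(n + 1)\<close>-simplices. In both cases \<open>i \<le> n\<close>.\<close>

record 's sset =
  simplices :: "nat \<Rightarrow> 's set"
  face :: "nat \<Rightarrow> nat \<Rightarrow> 's \<Rightarrow> 's"
  degen :: "nat \<Rightarrow> nat \<Rightarrow> 's \<Rightarrow> 's"

locale simplicial_set =
  fixes S :: "'s sset"
  assumes face_closed:
      "\<lbrakk>x \<in> simplices S (Suc n); i \<le> Suc n\<rbrakk> \<Longrightarrow> face S (Suc n) i x \<in> simplices S n"
    and degen_closed:
      "\<lbrakk>x \<in> simplices S n; i \<le> n\<rbrakk> \<Longrightarrow> degen S n i x \<in> simplices S (Suc n)"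
    and face_face:
      "\<lbrakk>x \<in> simplices S (Suc (Suc n)); i < j; j \<le> Suc (Suc n)\<rbrakk> \<Longrightarrow>
        face S (Suc n) i (face S (Suc (Suc n)) j x) = face S (Suc n) (j - 1) (face S (Suc (Suc n)) i x)"
    and face_degen_less:
      "\<lbrakk>x \<in> simplices S (Suc n); i < j; j \<le> Suc n\<rbrakk> \<Longrightarrow>
        face S (Suc (Suc n)) i (degen S (Suc n) j x) = degen S n (j - 1) (face S (Suc n) i x)"
    and face_degen_eq:
      "\<lbrakk>x \<in> simplices S n; j \<le> n; i = j \<or> i = Suc j\<rbrakk> \<Longrightarrow> face S (Suc n) i (degen S n j x) = x"
    and face_degen_greater:
      "\<lbrakk>x \<in> simplices S (Suc n); Suc j < i; i \<le> Suc (Suc n)\<rbrakk> \<Longrightarrow>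
        face S (Suc (Suc n)) i (degen S (Suc n) j x) = degen S n j (face S (Suc n) (i - 1) x)"
    and degen_degen:
      "\<lbrakk>x \<in> simplices S n; i \<le> j; j \<le> n\<rbrakk> \<Longrightarrow>
        degen S (Suc n) i (degen S n j x) = degen S (Suc n) (Suc j) (degen S n i x)"

definition delete_entry :: "nat \<Rightarrow> 'a list \<Rightarrow> 'a list"
  where "delete_entry i xs = take i xs @ drop (Suc i) xs"

definition repeat_entry :: "nat \<Rightarrow> 'a list \<Rightarrow> 'a list"
  where "repeat_entry i xs = take (Suc i) xs @ drop i xs"

definition tuple_sset :: "(nat \<Rightarrow> 'a list set) \<Rightarrow> 'a list sset"
  where "tuple_sset A = \<lparr>simplices = A, face = (\<lambda>n. delete_entry), degen = (\<lambda>n. repeat_entry)\<rparr>"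

definition enriched_nerve :: "'a set \<Rightarrow> ('a \<Rightarrow> 'a \<Rightarrow> real) \<Rightarrow> real \<Rightarrow> 'a list sset"
  where "enriched_nerve X d \<epsilon> = tuple_sset (\<lambda>n. {xs. length xs = Suc n \<and> set xs \<subseteq> X \<and>
           (\<Sum>i<n. d (xs ! i) (xs ! Suc i)) \<le> \<epsilon>})"

definition vietoris_rips :: "'a set \<Rightarrow> ('a \<Rightarrow> 'a \<Rightarrow> real) \<Rightarrow> real \<Rightarrow> 'a list sset"
  where "vietoris_rips X d \<epsilon> = tuple_sset (\<lambda>n. {xs. length xs = Suc n \<and> set xs \<subseteq> X \<and>
           (\<forall>i\<le>n. \<forall>j\<le>n. d (xs ! i) (xs ! j) \<le> \<epsilon>)})"


section \<open>Chain complexes and homology\<close>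

text \<open>Chain complexes are indexed by the natural numbers. The map \<^term>\<open>bdry C n\<close> goes from degree
  \<open>n\<close> to degree \<open>n - 1\<close> for \<open>n \<ge> 1\<close>; the boundary out of degree \<open>0\<close> is the zero map by convention,
  so \<^term>\<open>bdry C 0\<close> is never consulted.\<close>

record 'c ch =
  chains :: "nat \<Rightarrow> 'c monoid"
  bdry :: "nat \<Rightarrow> 'c \<Rightarrow> 'c"

locale chain_complex =
  fixes C :: "'c ch"
  assumes chains_group: "comm_group (chains C n)"
    and bdry_hom: "bdry C (Suc n) \<in> hom (chains C (Suc n)) (chains C n)"
    and bdry_bdry: "c \<in> carrier (chains C (Suc (Suc n))) \<Longrightarrow>
      bdry C (Suc n) (bdry C (Suc (Suc n)) c) = \<one>\<^bsub>chains C n\<^esub>"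

definition chain_map :: "'c ch \<Rightarrow> 'e ch \<Rightarrow> (nat \<Rightarrow> 'c \<Rightarrow> 'e) \<Rightarrow> bool"
  where "chain_map C D f \<longleftrightarrow> (\<forall>n. f n \<in> hom (chains C n) (chains D n)) \<and>
    (\<forall>n. \<forall>c \<in> carrier (chains C (Suc n)). bdry D (Suc n) (f (Suc n) c) = f n (bdry C (Suc n) c))"

definition cycles :: "'c ch \<Rightarrow> nat \<Rightarrow> 'c set"
  where "cycles C k = (if k = 0 then carrier (chains C 0)
                       else kernel (chains C k) (chains C (k - 1)) (bdry C k))"

definition boundaries :: "'c ch \<Rightarrow> nat \<Rightarrow> 'c set"
  where "boundaries C k = bdry C (Suc k) ` carrier (chains C (Suc k))"

definition homology :: "nat \<Rightarrow> 'c ch \<Rightarrow> 'c set monoid"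
  where "homology k C = (chains C k)\<lparr>carrier := cycles C k\<rparr> Mod boundaries C k"

text \<open>The map induced on homology sends the class of a cycle \<open>z\<close> to the class of \<open>f k z\<close>; multiplying
  the image of a whole coset by the boundaries of the target gives exactly that coset.\<close>

definition homology_map ::
    "nat \<Rightarrow> 'e ch \<Rightarrow> (nat \<Rightarrow> 'c \<Rightarrow> 'e) \<Rightarrow> 'c set \<Rightarrow> 'e set"
  where "homology_map k D f A = boundaries D k <#>\<^bsub>chains D k\<^esub> (f k ` A)"

definition free_chains :: "'s sset \<Rightarrow> ('s \<Rightarrow>\<^sub>0 int) ch"
  where "free_chains S = \<lparr>chains = (\<lambda>n. free_Abelian_group (simplices S n)),
           bdry = (\<lambda>n c. \<Sum>i\<le>n. frag_cmul ((- 1) ^ i) (frag_extend (frag_of \<circ> face S n i) c))\<rparr>"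

definition free_chain_map :: "(nat \<Rightarrow> 's \<Rightarrow> 't) \<Rightarrow> nat \<Rightarrow> ('s \<Rightarrow>\<^sub>0 int) \<Rightarrow> ('t \<Rightarrow>\<^sub>0 int)"
  where "free_chain_map g n = frag_extend (frag_of \<circ> g n)"


section \<open>Limits of abelian groups over the positive reals\<close>

text \<open>A functor from the poset of positive reals to abelian groups consists of an object part \<open>F\<close>
  and a morphism part \<open>\<phi>\<close>, where \<open>\<phi> \<epsilon> \<epsilon>'\<close> is the image of the morphism \<open>\<epsilon> \<le> \<epsilon>'\<close>. Its limit is
  realised as the group of compatible families in the product; \<open>lim_pos_cone\<close> and
  \<open>lim_pos_universal\<close> below show that this is the categorical limit.\<close>

locale pos_functor =
  fixes F :: "real \<Rightarrow> 'b monoid" and \<phi> :: "real \<Rightarrow> real \<Rightarrow> 'b \<Rightarrow> 'b"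
  assumes obj: "0 < \<epsilon> \<Longrightarrow> comm_group (F \<epsilon>)"
    and mor: "\<lbrakk>0 < \<epsilon>; \<epsilon> \<le> \<epsilon>'\<rbrakk> \<Longrightarrow> \<phi> \<epsilon> \<epsilon>' \<in> hom (F \<epsilon>) (F \<epsilon>')"
    and mor_id: "\<lbrakk>0 < \<epsilon>; x \<in> carrier (F \<epsilon>)\<rbrakk> \<Longrightarrow> \<phi> \<epsilon> \<epsilon> x = x"
    and mor_comp: "\<lbrakk>0 < \<epsilon>; \<epsilon> \<le> \<epsilon>'; \<epsilon>' \<le> \<epsilon>''; x \<in> carrier (F \<epsilon>)\<rbrakk> \<Longrightarrow>
      \<phi> \<epsilon>' \<epsilon>'' (\<phi> \<epsilon> \<epsilon>' x) = \<phi> \<epsilon> \<epsilon>'' x"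

definition lim_pos :: "(real \<Rightarrow> 'b monoid) \<Rightarrow> (real \<Rightarrow> real \<Rightarrow> 'b \<Rightarrow> 'b) \<Rightarrow> (real \<Rightarrow> 'b) monoid"
  where "lim_pos F \<phi> = (product_group {0<..} F)\<lparr>carrier :=
           {x \<in> carrier (product_group {0<..} F). \<forall>\<epsilon> \<epsilon>'. 0 < \<epsilon> \<and> \<epsilon> \<le> \<epsilon>' \<longrightarrow> \<phi> \<epsilon> \<epsilon>' (x \<epsilon>) = x \<epsilon>'}\<rparr>"

definition pos_cone ::
    "(real \<Rightarrow> 'b monoid) \<Rightarrow> (real \<Rightarrow> real \<Rightarrow> 'b \<Rightarrow> 'b) \<Rightarrow> 'h monoid \<Rightarrow> (real \<Rightarrow> 'h \<Rightarrow> 'b) \<Rightarrow> bool"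
  where "pos_cone F \<phi> L p \<longleftrightarrow> comm_group L \<and> (\<forall>\<epsilon>>0. p \<epsilon> \<in> hom L (F \<epsilon>)) \<and>
    (\<forall>\<epsilon> \<epsilon>'. 0 < \<epsilon> \<and> \<epsilon> \<le> \<epsilon>' \<longrightarrow> (\<forall>x \<in> carrier L. \<phi> \<epsilon> \<epsilon>' (p \<epsilon> x) = p \<epsilon>' x))"


section \<open>Vietoris homology\<close>

definition CN :: "'a set \<Rightarrow> ('a \<Rightarrow> 'a \<Rightarrow> real) \<Rightarrow> real \<Rightarrow> ('a list \<Rightarrow>\<^sub>0 int) ch"
  where "CN X d \<epsilon> = free_chains (enriched_nerve X d \<epsilon>)"

definition CV :: "'a set \<Rightarrow> ('a \<Rightarrow> 'a \<Rightarrow> real) \<Rightarrow> real \<Rightarrow> ('a list \<Rightarrow>\<^sub>0 int) ch"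
  where "CV X d \<epsilon> = free_chains (vietoris_rips X d \<epsilon>)"

text \<open>For \<open>0 < \<epsilon> \<le> \<epsilon>'\<close> the simplicial sets at \<open>\<epsilon>\<close> are contained in those at \<open>\<epsilon>'\<close>, and the structure
  map is the inclusion, whose underlying function is \<open>\<lambda>n xs. xs\<close>.\<close>

definition lim_homology ::
    "nat \<Rightarrow> (real \<Rightarrow> ('s \<Rightarrow>\<^sub>0 int) ch) \<Rightarrow> (real \<Rightarrow> ('s \<Rightarrow>\<^sub>0 int) set) monoid"
  where "lim_homology k C = lim_pos (\<lambda>\<epsilon>. homology k (C \<epsilon>))
           (\<lambda>\<epsilon> \<epsilon>'. homology_map k (C \<epsilon>') (free_chain_map (\<lambda>n xs. xs)))"

definition vietoris_homology ::
    "nat \<Rightarrow> 'a set \<Rightarrow> ('a \<Rightarrow> 'a \<Rightarrow> real) \<Rightarrow> (real \<Rightarrow> ('a list \<Rightarrow>\<^sub>0 int) set) monoid"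
  where "vietoris_homology k X d = lim_homology k (CV X d)"


section \<open>Well-formedness of the definitions\<close>

text \<open>The tuples form simplicial sets, their free chains form chain complexes, homology is functorial
  in the parameter, and \<open>lim_pos\<close> with the evaluation maps is a limit cone.\<close>

lemma tuple_sset_simps [simp]:
  "simplices (tuple_sset A) = A" "face (tuple_sset A) n = delete_entry"
  "degen (tuple_sset A) n = repeat_entry"
  by (simp_all add: tuple_sset_def)

lemma length_delete_entry: "i < length xs \<Longrightarrow> length (delete_entry i xs) = length xs - 1"
  by (auto simp: delete_entry_def min_def)

lemma length_repeat_entry: "i < length xs \<Longrightarrow> length (repeat_entry i xs) = Suc (length xs)"
  by (auto simp: repeat_entry_def min_def)

lemma nth_delete_entry:
  "\<lbrakk>i < length xs; Suc j < length xs\<rbrakk> \<Longrightarrow> delete_entry i xs ! j = (if j < i then xs ! j else xs ! Suc j)"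
  by (simp add: delete_entry_def nth_append min_def)

lemma nth_repeat_entry:
  "\<lbrakk>i < length xs; j \<le> length xs\<rbrakk> \<Longrightarrow> repeat_entry i xs ! j = (if j \<le> i then xs ! j else xs ! (j - 1))"
  by (auto simp: repeat_entry_def nth_append min_def less_Suc_eq_le not_le intro!: arg_cong [where f = "nth xs"])

lemma set_delete_entry: "set (delete_entry i xs) \<subseteq> set xs"
  by (auto simp: delete_entry_def dest: in_set_takeD in_set_dropD)

lemma set_repeat_entry: "set (repeat_entry i xs) \<subseteq> set xs"
  by (auto simp: repeat_entry_def dest: in_set_takeD in_set_dropD)

lemma simplicial_set_tuple_sset:
  assumes len: "\<And>n xs. xs \<in> A n \<Longrightarrow> length xs = Suc n"
    and del: "\<And>n xs i. \<lbrakk>xs \<in> A (Suc n); i \<le> Suc n\<rbrakk> \<Longrightarrow> delete_entry i xs \<in> A n"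
    and rep: "\<And>n xs i. \<lbrakk>xs \<in> A n; i \<le> n\<rbrakk> \<Longrightarrow> repeat_entry i xs \<in> A (Suc n)"
  shows "simplicial_set (tuple_sset A)"
proof
qed (auto simp: del rep dest!: len
      intro!: nth_equalityI simp: length_delete_entry length_repeat_entry nth_delete_entry nth_repeat_entry)

lemma (in Metric_space) simplicial_set_vietoris_rips:
  assumes "0 \<le> \<epsilon>" shows "simplicial_set (vietoris_rips M d \<epsilon>)"
  unfolding vietoris_rips_def
proof (rule simplicial_set_tuple_sset)
  fix n xs i
  assume xs: "xs \<in> {xs. length xs = Suc (Suc n) \<and> set xs \<subseteq> M \<and>
      (\<forall>i\<le>Suc n. \<forall>j\<le>Suc n. d (xs ! i) (xs ! j) \<le> \<epsilon>)}" and "i \<le> Suc n"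
  then show "delete_entry i xs \<in> {xs. length xs = Suc n \<and> set xs \<subseteq> M \<and>
      (\<forall>i\<le>n. \<forall>j\<le>n. d (xs ! i) (xs ! j) \<le> \<epsilon>)}"
    using set_delete_entry [of i xs] by (auto simp: length_delete_entry nth_delete_entry)
next
  fix n xs i
  assume xs: "xs \<in> {xs. length xs = Suc n \<and> set xs \<subseteq> M \<and>
      (\<forall>i\<le>n. \<forall>j\<le>n. d (xs ! i) (xs ! j) \<le> \<epsilon>)}" and "i \<le> n"
  then show "repeat_entry i xs \<in> {xs. length xs = Suc (Suc n) \<and> set xs \<subseteq> M \<and>
      (\<forall>i\<le>Suc n. \<forall>j\<le>Suc n. d (xs ! i) (xs ! j) \<le> \<epsilon>)}"
    using set_repeat_entry [of i xs] by (auto simp: length_repeat_entry nth_repeat_entry)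
qed auto

lemma (in Metric_space) simplicial_set_enriched_nerve:
  "simplicial_set (enriched_nerve M d \<epsilon>)"
  unfolding enriched_nerve_def
proof (rule simplicial_set_tuple_sset)
  fix n xs i
  assume xs: "xs \<in> {xs. length xs = Suc (Suc n) \<and> set xs \<subseteq> M \<and>
      (\<Sum>i<Suc n. d (xs ! i) (xs ! Suc i)) \<le> \<epsilon>}" and i: "i \<le> Suc n"
  have inM: "xs ! j \<in> M" if "j \<le> Suc n" for j
    using xs that by (auto simp: subset_iff)
  let ?f = "\<lambda>j. d (xs ! j) (xs ! Suc j)"
  let ?g = "\<lambda>j. d (delete_entry i xs ! j) (delete_entry i xs ! Suc j)"
  have g: "?g j = (if Suc j < i then ?f j else if Suc j = i then d (xs ! j) (xs ! Suc (Suc j)) else ?f (Suc j))"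
    if "j < n" for j
    using xs i that by (auto simp: nth_delete_entry)
  have *: "sum ?g {..<m} \<le> (if m < i then sum ?f {..<m} else sum ?f {..<Suc m})" if "m \<le> n" for m
    using that
  proof (induction m)
    case (Suc m)
    have "d (xs ! m) (xs ! Suc (Suc m)) \<le> ?f m + ?f (Suc m)"
      using Suc by (intro triangle inM) auto
    with Suc show ?case
      by (auto simp: g split: if_splits)
  qed auto
  have "sum ?g {..<n} \<le> sum ?f {..<Suc n}"
    using * [of n] by (auto simp: add_increasing2 split: if_splits)
  with xs i set_delete_entry [of i xs]
  show "delete_entry i xs \<in> {xs. length xs = Suc n \<and> set xs \<subseteq> M \<and>
      (\<Sum>i<n. d (xs ! i) (xs ! Suc i)) \<le> \<epsilon>}"
    by (auto simp: length_delete_entry)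
next
  fix n xs i
  assume xs: "xs \<in> {xs. length xs = Suc n \<and> set xs \<subseteq> M \<and>
      (\<Sum>i<n. d (xs ! i) (xs ! Suc i)) \<le> \<epsilon>}" and i: "i \<le> n"
  let ?f = "\<lambda>j. d (xs ! j) (xs ! Suc j)"
  let ?g = "\<lambda>j. d (repeat_entry i xs ! j) (repeat_entry i xs ! Suc j)"
  have inM: "xs ! j \<in> M" if "j \<le> n" for j
    using xs that by (auto simp: subset_iff)
  have g: "?g j = (if j < i then ?f j else if j = i then 0 else ?f (j - 1))" if "j \<le> n" for j
    using xs i that inM by (auto simp: nth_repeat_entry)
  have *: "sum ?g {..<m} = (if m \<le> i then sum ?f {..<m} else sum ?f {..<m - 1})" if "m \<le> Suc n" for m
    using that
  proof (induction m)
    case (Suc m)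
    then show ?case
      by (cases m) (auto simp: g)
  qed auto
  have "sum ?g {..<Suc n} = sum ?f {..<n}"
    using * [of "Suc n"] i by auto
  with xs i set_repeat_entry [of i xs]
  show "repeat_entry i xs \<in> {xs. length xs = Suc (Suc n) \<and> set xs \<subseteq> M \<and>
      (\<Sum>i<Suc n. d (xs ! i) (xs ! Suc i)) \<le> \<epsilon>}"
    by (simp add: length_repeat_entry del: sum.lessThan_Suc) blast
qed auto

lemma enriched_nerve_mono:
  "\<epsilon> \<le> \<epsilon>' \<Longrightarrow> simplices (enriched_nerve X d \<epsilon>) n \<subseteq> simplices (enriched_nerve X d \<epsilon>') n"
  by (auto simp: enriched_nerve_def)

lemma vietoris_rips_mono:
  "\<epsilon> \<le> \<epsilon>' \<Longrightarrow> simplices (vietoris_rips X d \<epsilon>) n \<subseteq> simplices (vietoris_rips X d \<epsilon>') n"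
  by (force simp: vietoris_rips_def)

lemma free_chains_simps [simp]:
  "chains (free_chains S) n = free_Abelian_group (simplices S n)"
  "bdry (free_chains S) n c = (\<Sum>i\<le>n. frag_cmul ((- 1) ^ i) (frag_extend (frag_of \<circ> face S n i) c))"
  by (simp_all add: free_chains_def)

lemma frag_extend_of_in_free_Abelian_group:
  assumes "c \<in> carrier (free_Abelian_group A)" "f ` A \<subseteq> B"
  shows "frag_extend (frag_of \<circ> f) c \<in> carrier (free_Abelian_group B)"
proof -
  have "Poly_Mapping.keys (frag_extend (frag_of \<circ> f) c) \<subseteq> f ` Poly_Mapping.keys c"
    using keys_frag_extend [of "frag_of \<circ> f" c] by auto
  then show ?thesis
    using assms by auto
qed

lemma chain_complex_free_chains:
  assumes "simplicial_set S" shows "chain_complex (free_chains S)"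
proof -
  interpret simplicial_set S by fact
  show ?thesis
  proof (rule chain_complex.intro)
    fix n
    show "comm_group (chains (free_chains S) n)"
      by (simp add: abelian_free_Abelian_group)
  next
    fix n
    let ?d = "\<lambda>i c. frag_extend (frag_of \<circ> face S (Suc n) i) c"
    have cl: "?d i c \<in> carrier (free_Abelian_group (simplices S n))"
      if "c \<in> carrier (free_Abelian_group (simplices S (Suc n)))" "i \<le> Suc n" for c i
      using that face_closed by (intro frag_extend_of_in_free_Abelian_group) auto
    show "bdry (free_chains S) (Suc n) \<in> hom (chains (free_chains S) (Suc n)) (chains (free_chains S) n)"
    proof (rule homI)
      fix c assume "c \<in> carrier (chains (free_chains S) (Suc n))"
      then have c: "c \<in> carrier (free_Abelian_group (simplices S (Suc n)))" by simp
      have "Poly_Mapping.keys (\<Sum>i\<le>Suc n. frag_cmul ((- 1) ^ i) (?d i c)) \<subseteq> simplices S n"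
        by (rule order_trans [OF keys_sum]) (use cl [OF c] in fastforce)
      then show "bdry (free_chains S) (Suc n) c \<in> carrier (chains (free_chains S) n)"
        by (simp del: sum.atMost_Suc)
    qed (simp add: frag_extend_add frag_cmul_distrib2 sum.distrib del: sum.atMost_Suc)
  next
    fix n c
    let ?P = "\<lambda>c. bdry (free_chains S) (Suc n) (bdry (free_chains S) (Suc (Suc n)) c) = 0"
    assume "c \<in> carrier (chains (free_chains S) (Suc (Suc n)))"
    then have "Poly_Mapping.keys c \<subseteq> simplices S (Suc (Suc n))" by simp
    then have "?P c"
    proof (induction rule: frag_induction)
      case (one x)
      define p where "p = Suc (Suc n)"
      have eql: "{..p} \<times> {..Suc n} \<inter> {(x, y). y < x} = (\<lambda>(j,i). (Suc i, j)) ` {(i,j). i \<le> j \<and> j \<le> Suc n}"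
        by (auto simp: image_def p_def) (metis Suc_le_mono less_Suc_eq_le not0_implies_Suc not_less_zero)
      have eqr: "{..p} \<times> {..Suc n} - {(x, y). y < x} = {(i,j). i \<le> j \<and> j \<le> Suc n}"
        by (auto simp: p_def)
      have eqf: "face S (Suc n) i (face S p (Suc j) x) = face S (Suc n) j (face S p i x)"
        if "i \<le> j" "j \<le> Suc n" for i j
        using face_face [OF one, of i "Suc j"] that by (simp add: p_def)
      have eq0: "frag_cmul (-1) a = b \<Longrightarrow> a + b = 0" for a b :: "'a \<Rightarrow>\<^sub>0 int"
        by (simp add: neg_eq_iff_add_eq_0)
      have "(\<Sum>x'\<le>p. \<Sum>i\<le>Suc n. frag_cmul ((-1) ^ (x' + i)) (frag_of (face S (Suc n) i (face S p x' x)))) = 0"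
        apply (simp add: sum.cartesian_product sum.Int_Diff [of "_ \<times> _" _ "{(x,y). y < x}"] del: sum.atMost_Suc)
        apply (rule eq0)
        unfolding frag_cmul_sum prod.case_distrib [of "frag_cmul (-1)"] frag_cmul_cmul eql eqr
        apply (force simp: inj_on_def sum.reindex add.commute eqf intro: sum.cong)
        done
      then have "(\<Sum>i\<le>Suc n. \<Sum>x'\<le>p. frag_cmul ((-1) ^ (x' + i)) (frag_of (face S (Suc n) i (face S p x' x)))) = 0"
        by (subst sum.swap)
      then show ?case
        by (simp add: p_def frag_extend_sum frag_extend_cmul frag_cmul_sum power_add mult.commute
            del: sum.atMost_Suc)
    next
      case (diff a b)
      have "frag_cmul k (u - v) = frag_cmul k u - frag_cmul k v" for k and u v :: "'a \<Rightarrow>\<^sub>0 int"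
        by (rule poly_mapping_eqI) (simp add: lookup_minus right_diff_distrib)
      with diff show ?case
        by (simp add: frag_extend_diff sum_subtractf del: sum.atMost_Suc)
    qed simp
    then show "bdry (free_chains S) (Suc n) (bdry (free_chains S) (Suc (Suc n)) c) = \<one>\<^bsub>chains (free_chains S) n\<^esub>"
      by simp
  qed
qed


context chain_complex
begin

lemma bdry_group_hom: "group_hom (chains C (Suc n)) (chains C n) (bdry C (Suc n))"
  using chains_group bdry_hom by (simp add: group_hom_def group_hom_axioms_def comm_group.axioms)

lemma subgroup_cycles: "subgroup (cycles C k) (chains C k)"
proof (cases k)
  case 0
  interpret comm_group "chains C 0" by (rule chains_group)
  show ?thesis using 0 by (simp add: cycles_def subgroup_self)
next
  case (Suc n)
  then show ?thesis
    using group_hom.subgroup_kernel [OF bdry_group_hom] by (simp add: cycles_def)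
qed

lemma subgroup_boundaries: "subgroup (boundaries C k) (chains C k)"
  unfolding boundaries_def by (rule group_hom.img_is_subgroup [OF bdry_group_hom])

lemma boundaries_subset_cycles: "boundaries C k \<subseteq> cycles C k"
proof (cases k)
  case 0
  then show ?thesis
    using subgroup.subset [OF subgroup_boundaries [of 0]] by (simp add: cycles_def)
next
  case (Suc n)
  then show ?thesis
    using bdry_bdry [of _ n] bdry_hom [of "Suc n"]
    by (auto simp: cycles_def boundaries_def kernel_def hom_def)
qed

lemma comm_group_cycles: "comm_group ((chains C k)\<lparr>carrier := cycles C k\<rparr>)"
proof -
  interpret comm_group "chains C k" by (rule chains_group)
  show ?thesis
    using subgroup.subset [OF subgroup_cycles [of k]]
    by (intro group.group_comm_groupI subgroup.subgroup_is_group subgroup_cycles is_group)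
      (auto intro: m_comm)
qed

lemma subgroup_boundaries_cycles:
  "subgroup (boundaries C k) ((chains C k)\<lparr>carrier := cycles C k\<rparr>)"
  using group.subgroup_incl [OF _ subgroup_boundaries subgroup_cycles boundaries_subset_cycles]
    chains_group comm_group.axioms(2) by blast

lemma comm_group_homology: "comm_group (homology k C)"
  unfolding homology_def
  by (rule comm_group.abelian_FactGroup [OF comm_group_cycles subgroup_boundaries_cycles])

lemma carrier_homology:
  "carrier (homology k C) = (\<lambda>z. boundaries C k #>\<^bsub>chains C k\<^esub> z) ` cycles C k"
  by (simp add: homology_def carrier_FactGroup r_coset_def)

lemma mult_homology_cosets:
  assumes "y \<in> cycles C k" "z \<in> cycles C k"
  shows "(boundaries C k #>\<^bsub>chains C k\<^esub> y) \<otimes>\<^bsub>homology k C\<^esub> (boundaries C k #>\<^bsub>chains C k\<^esub> z) =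
         boundaries C k #>\<^bsub>chains C k\<^esub> (y \<otimes>\<^bsub>chains C k\<^esub> z)"
proof -
  interpret comm_group "chains C k" by (rule chains_group)
  interpret normal "boundaries C k" "chains C k"
    by (rule subgroup_imp_normal [OF subgroup_boundaries])
  have "(boundaries C k #>\<^bsub>chains C k\<^esub> y) <#>\<^bsub>chains C k\<^esub> (boundaries C k #>\<^bsub>chains C k\<^esub> z) =
         boundaries C k #>\<^bsub>chains C k\<^esub> (y \<otimes>\<^bsub>chains C k\<^esub> z)"
    using assms subgroup.subset [OF subgroup_cycles [of k]] by (intro rcos_sum) auto
  then show ?thesis
    by (simp add: homology_def set_mult_def)
qed

end

locale chain_complex_map = C: chain_complex C + D: chain_complex D
  for C :: "'c ch" and D :: "'e ch" +
  fixes f assumes f: "chain_map C D f"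
begin

lemma f_hom: "f n \<in> hom (chains C n) (chains D n)"
  using f by (simp add: chain_map_def)

lemma f_bdry:
  "c \<in> carrier (chains C (Suc n)) \<Longrightarrow> bdry D (Suc n) (f (Suc n) c) = f n (bdry C (Suc n) c)"
  using f by (simp add: chain_map_def)

lemma f_cycles: assumes "z \<in> cycles C k" shows "f k z \<in> cycles D k"
proof (cases k)
  case 0
  then show ?thesis using assms f_hom [of 0] by (auto simp: cycles_def hom_def)
next
  case (Suc n)
  have "f n \<one>\<^bsub>chains C n\<^esub> = \<one>\<^bsub>chains D n\<^esub>"
    using f_hom C.chains_group D.chains_group
    by (simp add: comm_group.axioms(2) hom_one)
  then show ?thesis
    using assms Suc f_hom [of k] f_bdry [of z n]
    by (auto simp: cycles_def hom_def kernel_def)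
qed

lemma f_boundaries: "f k ` boundaries C k \<subseteq> boundaries D k"
  using f_hom [of "Suc k"] by (auto simp: boundaries_def hom_def simp flip: f_bdry)

lemma homology_map_coset:
  assumes z: "z \<in> cycles C k"
  shows "homology_map k D f (boundaries C k #>\<^bsub>chains C k\<^esub> z) = boundaries D k #>\<^bsub>chains D k\<^esub> f k z"
proof -
  interpret CC: comm_group "chains C k" by (rule C.chains_group)
  interpret DD: comm_group "chains D k" by (rule D.chains_group)
  have zc: "z \<in> carrier (chains C k)"
    using z C.subgroup_cycles subgroup.subset by blast
  have bc: "b \<in> carrier (chains C k)" if "b \<in> boundaries C k" for b
    using that C.subgroup_boundaries subgroup.subset by blast
  have fc: "f k c \<in> carrier (chains D k)" if "c \<in> carrier (chains C k)" for c
    using that f_hom [of k] by (auto simp: hom_def)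
  have bd: "b \<in> carrier (chains D k)" if "b \<in> boundaries D k" for b
    using that D.subgroup_boundaries subgroup.subset by blast
  have fm: "f k (b \<otimes>\<^bsub>chains C k\<^esub> z) = f k b \<otimes>\<^bsub>chains D k\<^esub> f k z" if "b \<in> boundaries C k" for b
    using f_hom [of k] bc [OF that] zc by (simp add: hom_mult)
  have one: "f k \<one>\<^bsub>chains C k\<^esub> = \<one>\<^bsub>chains D k\<^esub>" "\<one>\<^bsub>chains C k\<^esub> \<in> boundaries C k"
    using f_hom C.subgroup_boundaries by (auto simp: hom_one subgroup.one_closed)
  have mem: "b \<otimes>\<^bsub>chains D k\<^esub> f k c \<in> boundaries D k" if "b \<in> boundaries D k" "c \<in> boundaries C k" for b c
    using that f_boundaries D.subgroup_boundaries subgroup.m_closed by fastforce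
  show ?thesis
  proof
    show "homology_map k D f (boundaries C k #>\<^bsub>chains C k\<^esub> z) \<subseteq> boundaries D k #>\<^bsub>chains D k\<^esub> f k z"
      using mem by (fastforce simp: homology_map_def set_mult_def r_coset_def fm bd bc fc zc
          simp flip: DD.m_assoc)
    show "boundaries D k #>\<^bsub>chains D k\<^esub> f k z \<subseteq> homology_map k D f (boundaries C k #>\<^bsub>chains C k\<^esub> z)"
    proof
      fix y assume "y \<in> boundaries D k #>\<^bsub>chains D k\<^esub> f k z"
      then obtain b where b: "b \<in> boundaries D k" "y = b \<otimes>\<^bsub>chains D k\<^esub> f k z"
        by (auto simp: r_coset_def)
      moreover have "z = \<one>\<^bsub>chains C k\<^esub> \<otimes>\<^bsub>chains C k\<^esub> z"
        using zc by simp
      ultimately show "y \<in> homology_map k D f (boundaries C k #>\<^bsub>chains C k\<^esub> z)"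
        unfolding homology_map_def set_mult_def r_coset_def using one by blast
    qed
  qed
qed

lemma homology_map_hom: "homology_map k D f \<in> hom (homology k C) (homology k D)"
proof (rule homI)
  fix x assume "x \<in> carrier (homology k C)"
  then show "homology_map k D f x \<in> carrier (homology k D)"
    by (auto simp: C.carrier_homology D.carrier_homology homology_map_coset f_cycles)
next
  fix x y assume "x \<in> carrier (homology k C)" "y \<in> carrier (homology k C)"
  then obtain u v where u: "u \<in> cycles C k" "x = boundaries C k #>\<^bsub>chains C k\<^esub> u"
    and v: "v \<in> cycles C k" "y = boundaries C k #>\<^bsub>chains C k\<^esub> v"
    by (auto simp: C.carrier_homology)
  have "u \<otimes>\<^bsub>chains C k\<^esub> v \<in> cycles C k"
    using u v C.subgroup_cycles subgroup.m_closed by fastforce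
  moreover have "f k (u \<otimes>\<^bsub>chains C k\<^esub> v) = f k u \<otimes>\<^bsub>chains D k\<^esub> f k v"
    using u v subgroup.subset [OF C.subgroup_cycles [of k]] by (intro hom_mult [OF f_hom]) auto
  ultimately show "homology_map k D f (x \<otimes>\<^bsub>homology k C\<^esub> y) =
      homology_map k D f x \<otimes>\<^bsub>homology k D\<^esub> homology_map k D f y"
    using u v by (simp add: C.mult_homology_cosets D.mult_homology_cosets homology_map_coset f_cycles)
qed

end

lemma free_chain_map_incl [simp]: "free_chain_map (\<lambda>n x. x) n c = c"
  using frag_expansion [of c] by (simp add: free_chain_map_def comp_def)

lemma pos_functor_homology:
  assumes S: "\<And>\<epsilon>. 0 < \<epsilon> \<Longrightarrow> simplicial_set (S \<epsilon>)"
    and mono: "\<And>\<epsilon> \<epsilon>' n. \<lbrakk>0 < \<epsilon>; \<epsilon> \<le> \<epsilon>'\<rbrakk> \<Longrightarrow> simplices (S \<epsilon>) n \<subseteq> simplices (S \<epsilon>') n"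
    and face: "\<And>\<epsilon> \<epsilon>' n. face (S \<epsilon>) n = face (S \<epsilon>') n"
  shows "pos_functor (\<lambda>\<epsilon>. homology k (free_chains (S \<epsilon>)))
    (\<lambda>\<epsilon> \<epsilon>'. homology_map k (free_chains (S \<epsilon>')) (free_chain_map (\<lambda>n xs. xs)))"
proof -
  have cc: "chain_complex (free_chains (S \<epsilon>))" if "0 < \<epsilon>" for \<epsilon>
    using chain_complex_free_chains S that by blast
  have ccm: "chain_complex_map (free_chains (S \<epsilon>)) (free_chains (S \<epsilon>')) (free_chain_map (\<lambda>n xs. xs))"
    if "0 < \<epsilon>" "\<epsilon> \<le> \<epsilon>'" for \<epsilon> \<epsilon>'
  proof -
    have "chain_map (free_chains (S \<epsilon>)) (free_chains (S \<epsilon>')) (free_chain_map (\<lambda>n xs. xs))"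
      using mono [OF that] face [of \<epsilon> _ \<epsilon>'] by (fastforce simp: chain_map_def hom_def)
    then show ?thesis
      using cc that by (simp add: chain_complex_map_def chain_complex_map_axioms_def)
  qed
  show ?thesis
  proof (rule pos_functor.intro)
    fix \<epsilon> :: real assume "0 < \<epsilon>"
    then show "comm_group (homology k (free_chains (S \<epsilon>)))"
      using cc chain_complex.comm_group_homology by blast
  next
    fix \<epsilon> \<epsilon>' :: real assume "0 < \<epsilon>" "\<epsilon> \<le> \<epsilon>'"
    then show "homology_map k (free_chains (S \<epsilon>')) (free_chain_map (\<lambda>n xs. xs))
        \<in> hom (homology k (free_chains (S \<epsilon>))) (homology k (free_chains (S \<epsilon>')))"
      using ccm chain_complex_map.homology_map_hom by blast
  next
    fix \<epsilon> :: real and x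
    assume "0 < \<epsilon>" "x \<in> carrier (homology k (free_chains (S \<epsilon>)))"
    then show "homology_map k (free_chains (S \<epsilon>)) (free_chain_map (\<lambda>n xs. xs)) x = x"
      using ccm [of \<epsilon> \<epsilon>] by (auto simp: chain_complex.carrier_homology [OF cc]
          chain_complex_map.homology_map_coset simp del: free_chains_simps)
  next
    fix \<epsilon> \<epsilon>' \<epsilon>'' :: real and x
    assume e: "0 < \<epsilon>" "\<epsilon> \<le> \<epsilon>'" "\<epsilon>' \<le> \<epsilon>''" and x: "x \<in> carrier (homology k (free_chains (S \<epsilon>)))"
    then obtain z where z: "z \<in> cycles (free_chains (S \<epsilon>)) k"
      and xz: "x = boundaries (free_chains (S \<epsilon>)) k #>\<^bsub>chains (free_chains (S \<epsilon>)) k\<^esub> z"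
      by (auto simp: chain_complex.carrier_homology [OF cc])
    have z': "z \<in> cycles (free_chains (S \<epsilon>')) k"
      using chain_complex_map.f_cycles [OF ccm z] e by simp
    show "homology_map k (free_chains (S \<epsilon>'')) (free_chain_map (\<lambda>n xs. xs))
        (homology_map k (free_chains (S \<epsilon>')) (free_chain_map (\<lambda>n xs. xs)) x) =
        homology_map k (free_chains (S \<epsilon>'')) (free_chain_map (\<lambda>n xs. xs)) x"
      using e chain_complex_map.homology_map_coset [OF ccm [of \<epsilon> \<epsilon>'] z]
        chain_complex_map.homology_map_coset [OF ccm [of \<epsilon> \<epsilon>''] z]
        chain_complex_map.homology_map_coset [OF ccm [of \<epsilon>' \<epsilon>''] z']
      by (simp add: xz)
  qed
qed

lemma pos_functor_CN:
  assumes "Metric_space X d"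
  shows "pos_functor (\<lambda>\<epsilon>. homology k (CN X d \<epsilon>))
    (\<lambda>\<epsilon> \<epsilon>'. homology_map k (CN X d \<epsilon>') (free_chain_map (\<lambda>n xs. xs)))"
  unfolding CN_def using assms
  by (intro pos_functor_homology Metric_space.simplicial_set_enriched_nerve enriched_nerve_mono)
    (simp_all add: enriched_nerve_def)

lemma pos_functor_CV:
  assumes "Metric_space X d"
  shows "pos_functor (\<lambda>\<epsilon>. homology k (CV X d \<epsilon>))
    (\<lambda>\<epsilon> \<epsilon>'. homology_map k (CV X d \<epsilon>') (free_chain_map (\<lambda>n xs. xs)))"
  unfolding CV_def using assms
  by (intro pos_functor_homology Metric_space.simplicial_set_vietoris_rips vietoris_rips_mono)
    (simp_all add: vietoris_rips_def)

context pos_functor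
begin

lemma comm_group_lim_pos: "comm_group (lim_pos F \<phi>)"
proof -
  let ?P = "product_group {0<..} F"
  interpret P: group ?P
    by (rule product_group) (auto intro: comm_group.axioms(2) obj)
  have sub: "subgroup (carrier (lim_pos F \<phi>)) ?P"
  proof (rule P.subgroupI)
    show "carrier (lim_pos F \<phi>) \<subseteq> carrier ?P"
      by (auto simp: lim_pos_def)
    have "\<one>\<^bsub>?P\<^esub> \<in> carrier (lim_pos F \<phi>)"
      using mor obj by (auto simp: lim_pos_def hom_one comm_group.axioms(2) group.is_monoid monoid.one_closed)
    then show "carrier (lim_pos F \<phi>) \<noteq> {}" by blast
  next
    fix x assume x: "x \<in> carrier (lim_pos F \<phi>)"
    then have "inv\<^bsub>?P\<^esub> x = (\<lambda>\<epsilon>\<in>{0<..}. inv\<^bsub>F \<epsilon>\<^esub> x \<epsilon>)"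
      by (intro inv_product_group) (auto simp: lim_pos_def comm_group.axioms(2) obj)
    moreover have "\<phi> \<epsilon> \<epsilon>' (inv\<^bsub>F \<epsilon>\<^esub> x \<epsilon>) = inv\<^bsub>F \<epsilon>'\<^esub> x \<epsilon>'" if "0 < \<epsilon>" "\<epsilon> \<le> \<epsilon>'" for \<epsilon> \<epsilon>'
    proof -
      have "group_hom (F \<epsilon>) (F \<epsilon>') (\<phi> \<epsilon> \<epsilon>')"
        using that by (simp add: group_hom_def group_hom_axioms_def comm_group.axioms(2) obj mor)
      then show ?thesis
        using group_hom.hom_inv x that by (fastforce simp: lim_pos_def)
    qed
    ultimately show "inv\<^bsub>?P\<^esub> x \<in> carrier (lim_pos F \<phi>)"
      using x by (auto simp: lim_pos_def PiE_iff comm_group.axioms(2) obj intro!: group.inv_closed)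
  next
    fix x y assume "x \<in> carrier (lim_pos F \<phi>)" "y \<in> carrier (lim_pos F \<phi>)"
    then show "x \<otimes>\<^bsub>?P\<^esub> y \<in> carrier (lim_pos F \<phi>)"
      by (auto simp: lim_pos_def PiE_iff hom_mult [OF mor] comm_group.axioms(2) obj
          intro!: monoid.m_closed group.is_monoid)
  qed
  have eq: "lim_pos F \<phi> = ?P\<lparr>carrier := carrier (lim_pos F \<phi>)\<rparr>"
    by (simp add: lim_pos_def)
  have "group (lim_pos F \<phi>)"
    by (subst eq) (rule subgroup.subgroup_is_group [OF sub P.is_group])
  then show ?thesis
    by (rule group.group_comm_groupI)
      (auto simp: lim_pos_def PiE_iff intro!: restrict_ext comm_monoid.m_comm comm_group.axioms(1) obj)
qed

theorem lim_pos_cone: "pos_cone F \<phi> (lim_pos F \<phi>) (\<lambda>\<epsilon> x. x \<epsilon>)"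
  using comm_group_lim_pos by (auto simp: pos_cone_def lim_pos_def hom_def)

theorem lim_pos_universal:
  assumes "pos_cone F \<phi> L p"
  shows "\<exists>h \<in> hom L (lim_pos F \<phi>). (\<forall>x \<in> carrier L. \<forall>\<epsilon>>0. h x \<epsilon> = p \<epsilon> x) \<and>
    (\<forall>h' \<in> hom L (lim_pos F \<phi>). (\<forall>x \<in> carrier L. \<forall>\<epsilon>>0. h' x \<epsilon> = p \<epsilon> x) \<longrightarrow>
       (\<forall>x \<in> carrier L. h' x = h x))"
proof (intro bexI conjI ballI impI allI)
  show "(\<lambda>x. \<lambda>\<epsilon>\<in>{0<..}. p \<epsilon> x) \<in> hom L (lim_pos F \<phi>)"
    using assms by (auto simp: pos_cone_def lim_pos_def hom_def Pi_iff intro!: restrict_ext)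
next
  fix h' x
  assume "h' \<in> hom L (lim_pos F \<phi>)" "\<forall>x \<in> carrier L. \<forall>\<epsilon>>0. h' x \<epsilon> = p \<epsilon> x" "x \<in> carrier L"
  then show "h' x = (\<lambda>\<epsilon>\<in>{0<..}. p \<epsilon> x)"
    by (auto simp: lim_pos_def hom_def Pi_iff PiE_iff extensional_def fun_eq_iff)
qed auto

end

end

theory Submission
  imports Defs
begin

text \<open>The two filtrations are interleaved, up to a rescaling of the parameter that depends on \<open>k\<close>.
  A tuple of path length at most \<open>\<epsilon>\<close> has diameter at most \<open>\<epsilon>\<close> by the triangle inequality, so the
  nerve at \<open>\<epsilon>\<close> lies in the Vietoris--Rips set at \<open>\<epsilon>\<close> (\<open>enriched_nerve_subset_vietoris_rips\<close>).
  Conversely an \<open>n\<close>-simplex of diameter at most \<open>\<epsilon>\<close> has path length at most \<open>n * \<epsilon>\<close>. This bound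
  grows with \<open>n\<close>, so no single rescaling turns it into a map of simplicial sets; but \<open>H\<^sub>k\<close> is
  determined by the chains of degree at most \<open>k + 1\<close>, and in these degrees the factor \<open>k + 1\<close>
  suffices (\<open>vietoris_rips_subset_enriched_nerve\<close>).

  Hence inclusion of chains induces maps
  \<open>H\<^sub>k (CN \<epsilon>) \<rightarrow> H\<^sub>k (CV \<epsilon>) \<rightarrow> H\<^sub>k (CN ((k + 1) \<epsilon>)) \<rightarrow> H\<^sub>k (CV ((k + 1) \<epsilon>))\<close>, in which any two
  consecutive maps compose to a structure map. A limit over the positive reals does not notice a
  rescaling, because \<open>\<epsilon> / (k + 1)\<close> is again positive, so the levelwise maps induce an isomorphism
  of limits (\<open>lim_pos_iso_of_interleaving\<close>).\<close>

section \<open>Interleaved functors have isomorphic limits\<close>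

text \<open>The inverse of the map induced by \<open>a\<close> takes a compatible family \<open>y\<close> to the family whose value
  at \<open>\<epsilon>\<close> is \<open>b (\<epsilon> / c) (y (\<epsilon> / c))\<close>. In either order, the two maps compose to the family of
  structure maps from \<open>\<epsilon> / c\<close> to \<open>\<epsilon>\<close>, and these fix every compatible family.\<close>

lemma lim_pos_iso_of_interleaving:
  fixes F G :: "real \<Rightarrow> 'b monoid" and c :: real
  assumes c: "1 \<le> c"
    and a_hom: "\<And>\<epsilon>. 0 < \<epsilon> \<Longrightarrow> a \<epsilon> \<in> hom (F \<epsilon>) (G \<epsilon>)"
    and a_nat: "\<And>\<epsilon> \<epsilon>' u. \<lbrakk>0 < \<epsilon>; \<epsilon> \<le> \<epsilon>'; u \<in> carrier (F \<epsilon>)\<rbrakk> \<Longrightarrow> \<psi> \<epsilon> \<epsilon>' (a \<epsilon> u) = a \<epsilon>' (\<phi> \<epsilon> \<epsilon>' u)"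
    and b_closed: "\<And>\<epsilon> v. \<lbrakk>0 < \<epsilon>; v \<in> carrier (G \<epsilon>)\<rbrakk> \<Longrightarrow> b \<epsilon> v \<in> carrier (F (c * \<epsilon>))"
    and b_nat: "\<And>\<epsilon> \<epsilon>' v. \<lbrakk>0 < \<epsilon>; \<epsilon> \<le> \<epsilon>'; v \<in> carrier (G \<epsilon>)\<rbrakk> \<Longrightarrow>
        \<phi> (c * \<epsilon>) (c * \<epsilon>') (b \<epsilon> v) = b \<epsilon>' (\<psi> \<epsilon> \<epsilon>' v)"
    and ba: "\<And>\<epsilon> u. \<lbrakk>0 < \<epsilon>; u \<in> carrier (F \<epsilon>)\<rbrakk> \<Longrightarrow> b \<epsilon> (a \<epsilon> u) = \<phi> \<epsilon> (c * \<epsilon>) u"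
    and ab: "\<And>\<epsilon> v. \<lbrakk>0 < \<epsilon>; v \<in> carrier (G \<epsilon>)\<rbrakk> \<Longrightarrow> a (c * \<epsilon>) (b \<epsilon> v) = \<psi> \<epsilon> (c * \<epsilon>) v"
  shows "lim_pos F \<phi> \<cong> lim_pos G \<psi>"
proof -
  have carrier_lim: "x \<in> carrier (lim_pos F' \<theta>) \<longleftrightarrow> x \<in> extensional {0<..} \<and>
      (\<forall>\<epsilon>>0. x \<epsilon> \<in> carrier (F' \<epsilon>)) \<and> (\<forall>\<epsilon> \<epsilon>'. 0 < \<epsilon> \<and> \<epsilon> \<le> \<epsilon>' \<longrightarrow> \<theta> \<epsilon> \<epsilon>' (x \<epsilon>) = x \<epsilon>')"
    for x \<theta> and F' :: "real \<Rightarrow> 'b monoid"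
    by (auto simp: lim_pos_def PiE_iff)
  have mult_lim: "x \<otimes>\<^bsub>lim_pos F' \<theta>\<^esub> y = (\<lambda>\<epsilon>\<in>{0<..}. x \<epsilon> \<otimes>\<^bsub>F' \<epsilon>\<^esub> y \<epsilon>)"
    for x y \<theta> and F' :: "real \<Rightarrow> 'b monoid"
    by (simp add: lim_pos_def)
  have a_closed: "a \<epsilon> u \<in> carrier (G \<epsilon>)" if "0 < \<epsilon>" "u \<in> carrier (F \<epsilon>)" for \<epsilon> u
    using a_hom that by (auto simp: hom_def)
  have shrink: "0 < \<epsilon> / c" "\<epsilon> / c \<le> \<epsilon>" "c * (\<epsilon> / c) = \<epsilon>" if "0 < \<epsilon>" for \<epsilon>
    using c that by (auto simp: divide_simps mult_le_cancel_left1)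
  define A where "A = (\<lambda>x. \<lambda>\<epsilon>\<in>{0<..}. a \<epsilon> (x \<epsilon>))"
  define B where "B = (\<lambda>y. \<lambda>\<epsilon>\<in>{0<..}. b (\<epsilon> / c) (y (\<epsilon> / c)))"
  have A_closed: "A x \<in> carrier (lim_pos G \<psi>)" if "x \<in> carrier (lim_pos F \<phi>)" for x
    using that by (auto simp: carrier_lim A_def a_closed a_nat)
  have B_closed: "B y \<in> carrier (lim_pos F \<phi>)" if y: "y \<in> carrier (lim_pos G \<psi>)" for y
  proof -
    have "b (\<epsilon> / c) (y (\<epsilon> / c)) \<in> carrier (F \<epsilon>)" if "0 < \<epsilon>" for \<epsilon>
      using b_closed [OF shrink(1) [OF that]] shrink [OF that] y by (simp add: carrier_lim)
    moreover have "\<phi> \<epsilon> \<epsilon>' (b (\<epsilon> / c) (y (\<epsilon> / c))) = b (\<epsilon>' / c) (y (\<epsilon>' / c))"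
      if "0 < \<epsilon>" "\<epsilon> \<le> \<epsilon>'" for \<epsilon> \<epsilon>'
    proof -
      have le: "\<epsilon> / c \<le> \<epsilon>' / c" and "0 < \<epsilon>'"
        using that c by (simp_all add: divide_right_mono)
      then show ?thesis
        using b_nat [OF shrink(1) [OF that(1)] le, of "y (\<epsilon> / c)"] shrink [OF that(1)] shrink(3) y
        by (simp add: carrier_lim)
    qed
    ultimately show ?thesis
      by (simp add: carrier_lim B_def)
  qed
  have BA: "B (A x) = x" if "x \<in> carrier (lim_pos F \<phi>)" for x
  proof (rule extensionalityI)
    show "B (A x) \<epsilon> = x \<epsilon>" if "\<epsilon> \<in> {0<..}" for \<epsilon>
      using that shrink [of \<epsilon>] \<open>x \<in> _\<close> ba [of "\<epsilon> / c" "x (\<epsilon> / c)"]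
      by (simp add: A_def B_def carrier_lim)
  qed (use that in \<open>auto simp: B_def carrier_lim\<close>)
  have AB: "A (B y) = y" if "y \<in> carrier (lim_pos G \<psi>)" for y
  proof (rule extensionalityI)
    show "A (B y) \<epsilon> = y \<epsilon>" if "\<epsilon> \<in> {0<..}" for \<epsilon>
      using that shrink [of \<epsilon>] \<open>y \<in> _\<close> ab [of "\<epsilon> / c" "y (\<epsilon> / c)"]
      by (simp add: A_def B_def carrier_lim)
  qed (use that in \<open>auto simp: A_def carrier_lim\<close>)
  have "A \<in> hom (lim_pos F \<phi>) (lim_pos G \<psi>)"
    by (rule homI) (auto simp: A_closed mult_lim, auto simp: A_def carrier_lim hom_mult [OF a_hom] intro!: restrict_ext)
  moreover have "bij_betw A (carrier (lim_pos F \<phi>)) (carrier (lim_pos G \<psi>))"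
    by (rule bij_betw_byWitness [of _ B]) (auto simp: A_closed B_closed AB BA)
  ultimately show ?thesis
    by (auto simp: is_iso_def iso_def)
qed

section \<open>Inclusions in low degrees and homology\<close>

text \<open>The homology in degree \<open>k\<close> is built from the chains in degrees \<open>k - 1\<close>, \<open>k\<close> and \<open>k + 1\<close>, so an
  inclusion of simplices up to degree \<open>k + 1\<close> already induces a map on it, although it need not be
  part of a chain map.\<close>

locale low_degree_inclusion =
  S: simplicial_set S + T: simplicial_set T for S T :: "'s sset" +
  fixes k :: nat
  assumes face_eq: "face S = face T"
    and incl: "n \<le> Suc k \<Longrightarrow> simplices S n \<subseteq> simplices T n"
begin

lemma chain_complexes: "chain_complex (free_chains S)" "chain_complex (free_chains T)"
  by (intro chain_complex_free_chains S.simplicial_set_axioms T.simplicial_set_axioms)+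

lemma cycles_subset: "cycles (free_chains S) k \<subseteq> cycles (free_chains T) k"
  using incl [of k] by (auto simp: cycles_def kernel_def face_eq)

lemma boundaries_subset: "boundaries (free_chains S) k \<subseteq> boundaries (free_chains T) k"
proof -
  have "bdry (free_chains S) n = bdry (free_chains T) n" for n
    by (simp add: free_chains_def face_eq)
  moreover have "carrier (chains (free_chains S) (Suc k)) \<subseteq> carrier (chains (free_chains T) (Suc k))"
    using incl [of "Suc k"] by auto
  ultimately show ?thesis
    by (simp add: boundaries_def image_mono del: free_chains_simps)
qed

abbreviation incl_homology :: "('s \<Rightarrow>\<^sub>0 int) set \<Rightarrow> ('s \<Rightarrow>\<^sub>0 int) set"
  where "incl_homology \<equiv> homology_map k (free_chains T) (free_chain_map (\<lambda>n x. x))"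

text \<open>The boundaries of \<open>S\<close> are boundaries of \<open>T\<close>, so they are absorbed when the subgroup of
  boundaries of \<open>T\<close> is added to a coset. Inclusion thus keeps the representing chain, which makes
  the induced maps additive and stable under composition.\<close>

lemma incl_homology_coset:
  "incl_homology (boundaries (free_chains S) k #>\<^bsub>chains (free_chains S) k\<^esub> z) =
   boundaries (free_chains T) k #>\<^bsub>chains (free_chains T) k\<^esub> z"
proof -
  have add: "u + v \<in> boundaries (free_chains T) k"
    if "u \<in> boundaries (free_chains T) k" "v \<in> boundaries (free_chains T) k" for u v
    using subgroup.m_closed [OF chain_complex.subgroup_boundaries [OF chain_complexes(2)] that] by simp
  have zero: "0 \<in> boundaries (free_chains S) k"
    using subgroup.one_closed [OF chain_complex.subgroup_boundaries [OF chain_complexes(1)]] by simp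
  let ?B = "boundaries (free_chains S) k" and ?B' = "boundaries (free_chains T) k"
  have "?B' <#>\<^bsub>chains (free_chains T) k\<^esub> (?B #>\<^bsub>chains (free_chains S) k\<^esub> z) =
      (\<Union>b'\<in>?B'. \<Union>b\<in>?B. {b' + b + z})"
    by (simp add: set_mult_def r_coset_def add.assoc del: free_chains_simps(2))
  also have "\<dots> = (\<Union>b'\<in>?B'. {b' + z})"
  proof
    show "(\<Union>b'\<in>?B'. \<Union>b\<in>?B. {b' + b + z}) \<subseteq> (\<Union>b'\<in>?B'. {b' + z})"
      using add boundaries_subset by blast
    have "b' + z \<in> (\<Union>b\<in>?B. {b' + b + z})" for b'
      using zero by (intro UN_I [of 0]) simp_all
    then show "(\<Union>b'\<in>?B'. {b' + z}) \<subseteq> (\<Union>b'\<in>?B'. \<Union>b\<in>?B. {b' + b + z})"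
      by blast
  qed
  finally show ?thesis
    by (simp add: homology_map_def r_coset_def del: free_chains_simps(2))
qed

lemma incl_homology_hom: "incl_homology \<in> hom (homology k (free_chains S)) (homology k (free_chains T))"
proof (rule homI)
  note carrier_S = chain_complex.carrier_homology [OF chain_complexes(1)]
    and carrier_T = chain_complex.carrier_homology [OF chain_complexes(2)]
  fix x assume "x \<in> carrier (homology k (free_chains S))"
  then obtain u where u: "u \<in> cycles (free_chains S) k"
      "x = boundaries (free_chains S) k #>\<^bsub>chains (free_chains S) k\<^esub> u"
    unfolding carrier_S by (rule imageE)
  have "u \<in> cycles (free_chains T) k"
    using u(1) cycles_subset by (rule rev_subsetD)
  then show "incl_homology x \<in> carrier (homology k (free_chains T))"
    unfolding u(2) incl_homology_coset carrier_T by (rule imageI)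
  fix y assume "y \<in> carrier (homology k (free_chains S))"
  then obtain v where v: "v \<in> cycles (free_chains S) k"
      "y = boundaries (free_chains S) k #>\<^bsub>chains (free_chains S) k\<^esub> v"
    unfolding carrier_S by (rule imageE)
  have mult: "u \<otimes>\<^bsub>chains (free_chains S) k\<^esub> v = u \<otimes>\<^bsub>chains (free_chains T) k\<^esub> v"
    unfolding free_chains_simps(1) mult_free_Abelian_group by (rule refl)
  have "u \<in> cycles (free_chains T) k" "v \<in> cycles (free_chains T) k"
    using u(1) v(1) cycles_subset by auto
  then show "incl_homology (x \<otimes>\<^bsub>homology k (free_chains S)\<^esub> y) =
      incl_homology x \<otimes>\<^bsub>homology k (free_chains T)\<^esub> incl_homology y"
    unfolding u(2) v(2) chain_complex.mult_homology_cosets [OF chain_complexes(1) u(1) v(1)]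
      incl_homology_coset mult
    by (rule chain_complex.mult_homology_cosets [OF chain_complexes(2), symmetric])
qed

end

lemma incl_homology_comp:
  assumes ST: "low_degree_inclusion S T k" and TU: "low_degree_inclusion T U k"
    and x: "x \<in> carrier (homology k (free_chains S))"
  shows "homology_map k (free_chains U) (free_chain_map (\<lambda>n x. x))
      (homology_map k (free_chains T) (free_chain_map (\<lambda>n x. x)) x) =
    homology_map k (free_chains U) (free_chain_map (\<lambda>n x. x)) x"
proof -
  interpret ST: low_degree_inclusion S T k by fact
  interpret TU: low_degree_inclusion T U k by fact
  interpret SU: low_degree_inclusion S U k
    by unfold_locales (simp add: ST.face_eq TU.face_eq, use ST.incl TU.incl in blast)
  obtain z where "x = boundaries (free_chains S) k #>\<^bsub>chains (free_chains S) k\<^esub> z"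
    using x unfolding chain_complex.carrier_homology [OF ST.chain_complexes(1)] by (rule imageE)
  then show ?thesis
    by (simp only: ST.incl_homology_coset TU.incl_homology_coset SU.incl_homology_coset)
qed

section \<open>The nerve and the Vietoris--Rips simplicial set are interleaved\<close>

lemma (in Metric_space) dist_le_path_length:
  assumes "\<And>l. l \<le> n \<Longrightarrow> p l \<in> M" "i \<le> j" "j \<le> n"
  shows "d (p i) (p j) \<le> (\<Sum>l<n. d (p l) (p (Suc l)))"
proof -
  have "d (p i) (p j) \<le> (\<Sum>l=i..<j. d (p l) (p (Suc l)))"
    using \<open>i \<le> j\<close> \<open>j \<le> n\<close>
  proof (induction j rule: dec_induct)
    case base
    with assms(1) [of i] show ?case by simp
  next
    case (step m)
    have "d (p i) (p (Suc m)) \<le> d (p i) (p m) + d (p m) (p (Suc m))"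
      using step by (intro triangle assms(1)) auto
    also have "\<dots> \<le> (\<Sum>l=i..<Suc m. d (p l) (p (Suc l)))"
      using step by (simp add: sum.atLeastLessThan_Suc)
    finally show ?case .
  qed
  also have "\<dots> \<le> (\<Sum>l<n. d (p l) (p (Suc l)))"
    using \<open>j \<le> n\<close> by (intro sum_mono2) auto
  finally show ?thesis .
qed

lemma (in Metric_space) enriched_nerve_subset_vietoris_rips:
  "simplices (enriched_nerve M d \<epsilon>) n \<subseteq> simplices (vietoris_rips M d \<epsilon>) n"
proof
  fix xs assume "xs \<in> simplices (enriched_nerve M d \<epsilon>) n"
  then have xs: "length xs = Suc n" "set xs \<subseteq> M" "(\<Sum>l<n. d (xs ! l) (xs ! Suc l)) \<le> \<epsilon>"
    by (auto simp: enriched_nerve_def)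
  have inM: "xs ! l \<in> M" if "l \<le> n" for l
    using xs that by (auto simp: subset_iff)
  have le: "d (xs ! i) (xs ! j) \<le> \<epsilon>" if "i \<le> j" "j \<le> n" for i j
    using dist_le_path_length [of n "nth xs" i j] inM that xs(3) by fastforce
  have "d (xs ! i) (xs ! j) \<le> \<epsilon>" if "i \<le> n" "j \<le> n" for i j
    using le [of i j] le [of j i] that by (cases "i \<le> j") (auto simp: commute)
  with xs show "xs \<in> simplices (vietoris_rips M d \<epsilon>) n"
    by (simp add: vietoris_rips_def)
qed

text \<open>The path has \<open>n\<close> edges of length at most \<open>\<epsilon>\<close>. The bound is stated for \<open>m \<ge> n\<close> because one
  factor has to serve all degrees up to \<open>m\<close>.\<close>

lemma vietoris_rips_subset_enriched_nerve:
  assumes "0 \<le> \<epsilon>" "n \<le> m"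
  shows "simplices (vietoris_rips X d \<epsilon>) n \<subseteq> simplices (enriched_nerve X d (real m * \<epsilon>)) n"
proof
  fix xs assume xs: "xs \<in> simplices (vietoris_rips X d \<epsilon>) n"
  then have "(\<Sum>l<n. d (xs ! l) (xs ! Suc l)) \<le> (\<Sum>l<n. \<epsilon>)"
    by (intro sum_mono) (auto simp: vietoris_rips_def)
  also have "\<dots> \<le> real m * \<epsilon>"
    using assms by (simp add: mult_right_mono)
  finally show "xs \<in> simplices (enriched_nerve X d (real m * \<epsilon>)) n"
    using xs by (auto simp: vietoris_rips_def enriched_nerve_def)
qed

theorem theorem33:
  fixes X :: "'a set" and d :: "'a \<Rightarrow> 'a \<Rightarrow> real" and k :: nat
  assumes "Metric_space X d"
  shows "lim_homology k (CN X d) \<cong> vietoris_homology k X d"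
proof -
  interpret Metric_space X d by fact
  let ?N = "enriched_nerve X d" and ?V = "vietoris_rips X d" and ?c = "real (Suc k)"
  note sset = simplicial_set_enriched_nerve simplicial_set_vietoris_rips
  have faces: "face (?N \<epsilon>) = (\<lambda>n. delete_entry)" "face (?V \<epsilon>) = (\<lambda>n. delete_entry)" for \<epsilon>
    by (simp_all add: enriched_nerve_def vietoris_rips_def tuple_sset_def)
  have NN: "low_degree_inclusion (?N \<epsilon>) (?N \<epsilon>') k" if "\<epsilon> \<le> \<epsilon>'" for \<epsilon> \<epsilon>'
    using that by (intro low_degree_inclusion.intro low_degree_inclusion_axioms.intro sset
        enriched_nerve_mono) (simp_all add: faces)
  have VV: "low_degree_inclusion (?V \<epsilon>) (?V \<epsilon>') k" if "0 < \<epsilon>" "\<epsilon> \<le> \<epsilon>'" for \<epsilon> \<epsilon>'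
    using that by (intro low_degree_inclusion.intro low_degree_inclusion_axioms.intro sset
        vietoris_rips_mono) (simp_all add: faces)
  have NV: "low_degree_inclusion (?N \<epsilon>) (?V \<epsilon>) k" if "0 < \<epsilon>" for \<epsilon>
    using that by (intro low_degree_inclusion.intro low_degree_inclusion_axioms.intro sset
        enriched_nerve_subset_vietoris_rips) (simp_all add: faces)
  have VN: "low_degree_inclusion (?V \<epsilon>) (?N (?c * \<epsilon>)) k" if "0 < \<epsilon>" for \<epsilon>
    using that by (intro low_degree_inclusion.intro low_degree_inclusion_axioms.intro sset
        vietoris_rips_subset_enriched_nerve) (simp_all add: faces)
  have scale: "0 < ?c * \<epsilon>" "\<epsilon> \<le> ?c * \<epsilon>" if "0 < \<epsilon>" for \<epsilon>
    using that by (simp_all add: mult_le_cancel_right1)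
  have scale_mono: "?c * \<epsilon> \<le> ?c * \<epsilon>'" if "\<epsilon> \<le> \<epsilon>'" for \<epsilon> \<epsilon>'
    using that by (simp add: mult_left_mono)
  \<comment> \<open>Every map below is induced by an inclusion, so each naturality and interleaving identity says
    that two composites of inclusions have the same source and target.\<close>
  note comp = incl_homology_comp [where k = k]
  show ?thesis
    unfolding lim_homology_def vietoris_homology_def CN_def CV_def
  proof (rule lim_pos_iso_of_interleaving [where c = ?c
        and a = "\<lambda>\<epsilon>. homology_map k (free_chains (?V \<epsilon>)) (free_chain_map (\<lambda>n xs. xs))"
        and b = "\<lambda>\<epsilon>. homology_map k (free_chains (?N (?c * \<epsilon>))) (free_chain_map (\<lambda>n xs. xs))"], goal_cases)
    case (2 \<epsilon>)
    then show ?case by (rule low_degree_inclusion.incl_homology_hom [OF NV])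
  next
    case (3 \<epsilon> \<epsilon>' u)
    then show ?case using comp [OF NV VV] comp [OF NN NV] by simp
  next
    case (4 \<epsilon> v)
    then show ?case using low_degree_inclusion.incl_homology_hom [OF VN] by (auto simp: hom_def)
  next
    case (5 \<epsilon> \<epsilon>' v)
    then show ?case
      using comp [OF VN NN [OF scale_mono]] comp [OF VV VN] by (simp del: of_nat_Suc)
  next
    case (6 \<epsilon> u)
    then show ?case by (intro comp [OF NV VN])
  next
    case (7 \<epsilon> v)
    then show ?case by (intro comp [OF VN NV] scale)
  qed simp_all
qed

end
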